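(* Consider the hybrid AC/DC network dynamics described in the context, in closed loop with the primary control scheme consisting of the droop control $$p^G = -\tilde Q\begin{bmatrix}\omega\\ mV\end{bmatrix}+p^G_{nom}$$ and, for every interlinking converter $x\in X$ with AC-side bus $i=X_x^{ac}$ and DC-side bus $j=X_x^{dc}$, the converter control $$\omega_i = mV_j ,$$ where $m>0$ is a constant. Let $(\eta^\ast,\omega^{G\ast},V^\ast)$ be an equilibrium point of this closed-loop system such that $|\eta^\ast_{ij}|<\frac{\pi}{2}$ for all $(i,j)\in E_{ac}$. Then there exists an open neighbourhood of this equilibrium point (in the state coordinates $(\eta,\omega^G,V)$) such that all solutions of the closed-loop system starting in this neighbourhood converge to the set of equilibrium points of the closed-loop system.
   Context: Network. $N=\{1,\dots,|N|\}$ is a finite set of buses and $E$ a finite set of transmission lines, each given an arbitrary direction. The buses are partitioned as $N=N_{ac}\cup N_{dc}$ into AC and DC buses, where $N_{ac}$ is the disjoint union of the bus sets $N_i^{ac}$ of the AC subsystems and $N_{dc}$ the disjoint union of the bus sets $N_k^{dc}$ of the DC subsystems. Each subsystem, with its lines, is a connected graph. $E=E_{ac}\cup E_{dc}$, where $E_{ac}$ (resp. $E_{dc}$) are the lines inside AC (resp. DC) subsystems; there are no lines between different subsystems. Different subsystems are connected only through interlinking converters (ILCs), forming the set $X$; ILC $x\in X$ connects an AC bus $X_x^{ac}\in N_{ac}$ to a DC bus $X_x^{dc}\in N_{dc}$. The overall network (lines together with ILCs) is connected, and each bus hosts at most one ILC. Let $X_{ac}=\{X_x^{ac}:x\in X\}$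 and $X_{dc}=\{X_x^{dc}:x\in X\}$. Variables and constants. $\omega_j$ ($j\in N_{ac}$) is the AC frequency deviation from nominal, $\eta_{ij}$ ($(i,j)\in E_{ac}$) the voltage angle difference between buses $i$ and $j$, $V_j$ ($j\in N_{dc}$) the DC voltage deviation from nominal, $p^G_j$ the generated power, $p^L_j$ the (constant) load, $p_{ij}$ the power transfer on line $(i,j)$, and $p^X_j$ the power leaving bus $j$ through the ILC. One has $p^X_j=0$ for $j\notin X_{ac}\cup X_{dc}$, and $p^X_{X_x^{dc}}=-p^X_{X_x^{ac}}$ for every $x\in X$ (instantaneous lossless converters). Also $p^G_j=0$ for $j\in X_{ac}$. Inertias $M_j>0$ and damping coefficients $D_j>0$ ($j\in N_{ac}\setminus X_{ac}$), capacitances $C_j>0$ ($j\in N_{dc}$), AC line susceptances $B_{ij}>0$ and DC line conductances $G_{ij}=1/R_{ij}>0$ (with $R_{ij}$ the line resistance) are constants. Dynamics. $$\dot\eta_{ij}=\omega_i-\omega_j,\quad (i,j)\in E_{ac},$$ $$M_j\dot\omega_j=p^G_j-p^L_j+\sum_{i:i\to j}p_{ij}-\sum_{k:j\to k}p_{jk}-D_j\omega_j,\quad j\in N_{ac}\setminus X_{ac},$$ $$0=p^G_j-p^L_j+\sum_{i:i\to j}p_{ij}-\sum_{k:j\to k}p_{jk}-p^X_j,\quad j\in X_{ac},$$ $$C_j\dot V_j=p^G_j-p^L_j+\sum_{i:i\to j}p_{ij}-\sum_{k:j\to k}p_{jk}-p^X_j,\quad j\in N_{dc},$$ with $p_{ij}=B_{ij}\sin\eta_{ij}$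 for $(i,j)\in E_{ac}$ and $p_{ij}=G_{ij}(V_i-V_j)$ for $(i,j)\in E_{dc}$. Here $i:i\to j$ and $k:j\to k$ range over predecessors and successors of $j$ in the directed graph $(N,E)$. Vectors. $\eta=[\eta_{ij}]_{(i,j)\in E_{ac}}$, $\omega=[\omega_j]_{j\in N_{ac}}$, $\omega^G=[\omega_j]_{j\in N_{ac}\setminus X_{ac}}$, $V=[V_j]_{j\in N_{dc}}$, $p^G=[p^G_j]_{j\in N}$ (AC buses first, then DC buses). Control data. $Q$ is a positive definite diagonal matrix of cost coefficients indexed by $N$; $\tilde Q$ is the diagonal matrix with $\tilde Q_{ii}=Q_{ii}^{-1}$ for $i\in N\setminus X_{ac}$ and $\tilde Q_{ii}=0$ for $i\in X_{ac}$. $p^G_{nom}$ is the constant nominal generation vector: the power allocation that is optimal when the frequencies are at their nominal values, i.e. the minimizer of $\frac12(p^G)^TQp^G$ subject to $p^G_j=0$ for $j\in X_{ac}$ and $\mathbf 1^Tp^G$ equal to a given nominal total load (so $p^G_{nom}=c\,\tilde Q\mathbf 1$ for some constant $c\in\mathbb R$). Equilibrium. An equilibrium is a constant state $(\eta^\ast,\omega^{G\ast},V^\ast)$ (with corresponding constant values of the remaining variables) at which $$0=\omega_i-\omega_j,\quad (i,j)\in E_{ac},$$ $$0=p^G_j-p^L_j+\sum_{i:i\to j}p_{ij}-\sum_{k:j\to k}p_{jk}-D_j\omega_j,\quad j\in N_{ac}\setminus X_{ac},$$ $$0=p^G_j-p^L_j+\sum_{i:i\to j}p_{ij}-\sum_{k:j\to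 k}p_{jk}-p^X_j,\quad j\in X_{ac}\cup N_{dc},$$ with $p_{ij}=B_{ij}\sin\eta_{ij}$ for $(i,j)\in E_{ac}$, $p_{ij}=G_{ij}(V_i-V_j)$ for $(i,j)\in E_{dc}$, $p^X_j=0$ for $j\notin X_{ac}\cup X_{dc}$, $p^X_{X_x^{dc}}=-p^X_{X_x^{ac}}$ for every $x\in X$, and with the control laws $p^G=-\tilde Q\begin{bmatrix}\omega\\ mV\end{bmatrix}+p^G_{nom}$ and $\omega_{X_x^{ac}}=mV_{X_x^{dc}}$ for every $x\in X$; in particular the frequencies of all AC buses in a common AC subsystem coincide. An equilibrium of the system is assumed to exist. *)

theory Defs
  imports "HOL-Analysis.Analysis" "HOL-Library.Disjoint_Sets"
begin

text \<open>The finite type \<open>'b\<close> is the set of all buses. Lines are ordered pairs of buses, the order being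
  the (arbitrary) direction. The parameter functions are only constrained, and only used, on the
  buses or lines where the parameter makes sense.\<close>

record ('b, 'x) hybrid_network =
  ac_subsystems :: "'b set set"
  dc_subsystems :: "'b set set"
  lines :: "('b \<times> 'b) set"
  ilcs :: "'x set"
  ilc_ac :: "'x \<Rightarrow> 'b"
  ilc_dc :: "'x \<Rightarrow> 'b"
  inertia :: "'b \<Rightarrow> real"
  damping :: "'b \<Rightarrow> real"
  capacitance :: "'b \<Rightarrow> real"
  susceptance :: "'b \<times> 'b \<Rightarrow> real"
  resistance :: "'b \<times> 'b \<Rightarrow> real"
  load :: "'b \<Rightarrow> real"

definition N_ac :: "('b, 'x) hybrid_network \<Rightarrow> 'b set" where
  "N_ac net = \<Union> (ac_subsystems net)"

definition N_dc :: "('b, 'x) hybrid_network \<Rightarrow> 'b set" where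
  "N_dc net = \<Union> (dc_subsystems net)"

definition E_ac :: "('b, 'x) hybrid_network \<Rightarrow> ('b \<times> 'b) set" where
  "E_ac net = {(i, j) \<in> lines net. \<exists>S \<in> ac_subsystems net. i \<in> S \<and> j \<in> S}"

definition E_dc :: "('b, 'x) hybrid_network \<Rightarrow> ('b \<times> 'b) set" where
  "E_dc net = {(i, j) \<in> lines net. \<exists>S \<in> dc_subsystems net. i \<in> S \<and> j \<in> S}"

definition X_ac :: "('b, 'x) hybrid_network \<Rightarrow> 'b set" where
  "X_ac net = ilc_ac net ` ilcs net"

definition X_dc :: "('b, 'x) hybrid_network \<Rightarrow> 'b set" where
  "X_dc net = ilc_dc net ` ilcs net"

definition conductance :: "('b, 'x) hybrid_network \<Rightarrow> 'b \<times> 'b \<Rightarrow> real" where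
  "conductance net e = 1 / resistance net e"

text \<open>Connectedness of the graph with vertex set \<open>A\<close> and those edges of \<open>R\<close> that have both ends in
  \<open>A\<close>, ignoring directions.\<close>

definition connected_graph :: "'b set \<Rightarrow> ('b \<times> 'b) set \<Rightarrow> bool" where
  "connected_graph A R \<longleftrightarrow>
     (let R' = R \<inter> A \<times> A in \<forall>i\<in>A. \<forall>j\<in>A. (i, j) \<in> (R' \<union> R'\<inverse>)\<^sup>*)"

text \<open>Since the AC and the DC buses are disjoint, injectivity of the two endpoint maps says that each
  bus hosts at most one converter.\<close>

definition valid_network :: "('b::finite, 'x) hybrid_network \<Rightarrow> bool" where
  "valid_network net \<longleftrightarrow>
     partition_on (N_ac net) (ac_subsystems net) \<and>
     partition_on (N_dc net) (dc_subsystems net) \<and>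
     N_ac net \<inter> N_dc net = {} \<and> N_ac net \<union> N_dc net = UNIV \<and>
     lines net = E_ac net \<union> E_dc net \<and>
     (\<forall>S \<in> ac_subsystems net \<union> dc_subsystems net. connected_graph S (lines net)) \<and>
     finite (ilcs net) \<and>
     X_ac net \<subseteq> N_ac net \<and> X_dc net \<subseteq> N_dc net \<and>
     inj_on (ilc_ac net) (ilcs net) \<and> inj_on (ilc_dc net) (ilcs net) \<and>
     connected_graph UNIV (lines net \<union> (\<lambda>x. (ilc_ac net x, ilc_dc net x)) ` ilcs net) \<and>
     (\<forall>j \<in> N_ac net - X_ac net. inertia net j > 0 \<and> damping net j > 0) \<and>
     (\<forall>j \<in> N_dc net. capacitance net j > 0) \<and>
     (\<forall>e \<in> E_ac net. susceptance net e > 0) \<and>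
     (\<forall>e \<in> E_dc net. resistance net e > 0)"

definition diagonal_matrix :: "real^'n^'n \<Rightarrow> bool" where
  "diagonal_matrix A \<longleftrightarrow> (\<forall>i j. i \<noteq> j \<longrightarrow> A $ i $ j = 0)"

definition positive_definite :: "real^'n^'n \<Rightarrow> bool" where
  "positive_definite A \<longleftrightarrow> transpose A = A \<and> (\<forall>v. v \<noteq> 0 \<longrightarrow> v \<bullet> (A *v v) > 0)"

definition Q_tilde :: "('b::finite, 'x) hybrid_network \<Rightarrow> real^'b^'b \<Rightarrow> real^'b^'b" where
  "Q_tilde net Q = (\<chi> i j. if i = j \<and> i \<notin> X_ac net then inverse (Q $ i $ i) else 0)"

text \<open>\<open>p_nom\<close> is the optimal allocation for the total load \<open>l_nom\<close>.\<close>

definition nominal_generation ::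
  "('b::finite, 'x) hybrid_network \<Rightarrow> real^'b^'b \<Rightarrow> real \<Rightarrow> real^'b \<Rightarrow> bool" where
  "nominal_generation net Q l_nom p_nom \<longleftrightarrow>
     is_arg_min (\<lambda>p. 1 / 2 * (p \<bullet> (Q *v p)))
       (\<lambda>p. (\<forall>j \<in> X_ac net. p $ j = 0) \<and> (\<Sum>j\<in>UNIV. p $ j) = l_nom) p_nom"

definition line_power ::
  "('b::finite, 'x) hybrid_network \<Rightarrow> real^('b \<times> 'b) \<Rightarrow> real^'b \<Rightarrow> 'b \<times> 'b \<Rightarrow> real" where
  "line_power net \<eta> V = (\<lambda>(i, j). if (i, j) \<in> E_ac net then susceptance net (i, j) * sin (\<eta> $ (i, j))
     else conductance net (i, j) * (V $ i - V $ j))"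

definition net_inflow :: "('b::finite, 'x) hybrid_network \<Rightarrow> ('b \<times> 'b \<Rightarrow> real) \<Rightarrow> 'b \<Rightarrow> real" where
  "net_inflow net p j =
     (\<Sum>i | (i, j) \<in> lines net. p (i, j)) - (\<Sum>k | (j, k) \<in> lines net. p (j, k))"

text \<open>Generation minus load plus net inflow from the lines. The terms \<open>D\<^sub>j \<omega>\<^sub>j\<close> and \<open>p\<^sup>X\<^sub>j\<close> are subtracted
  separately below.\<close>

definition bus_surplus ::
  "('b::finite, 'x) hybrid_network \<Rightarrow> real^('b \<times> 'b) \<Rightarrow> real^'b \<Rightarrow> real^'b \<Rightarrow> 'b \<Rightarrow> real" where
  "bus_surplus net \<eta> V pG j = pG $ j - load net j + net_inflow net (line_power net \<eta> V) j"

text \<open>The stacked vector \<open>[\<omega>; mV]\<close>, indexed by all buses.\<close>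

definition droop_signal ::
  "('b::finite, 'x) hybrid_network \<Rightarrow> real \<Rightarrow> real^'b \<Rightarrow> real^'b \<Rightarrow> real^'b" where
  "droop_signal net m \<omega> V = (\<chi> j. if j \<in> N_ac net then \<omega> $ j else m * V $ j)"

text \<open>The equations without derivatives: converter properties, power balance at the AC sides of the
  converters, droop control and converter control.\<close>

definition algebraic_relations ::
  "('b::finite, 'x) hybrid_network \<Rightarrow> real^'b^'b \<Rightarrow> real^'b \<Rightarrow> real \<Rightarrow>
   real^('b \<times> 'b) \<Rightarrow> real^'b \<Rightarrow> real^'b \<Rightarrow> real^'b \<Rightarrow> real^'b \<Rightarrow> bool" where
  "algebraic_relations net Q p_nom m \<eta> \<omega> V pG pX \<longleftrightarrow>
     (\<forall>j. j \<notin> X_ac net \<union> X_dc net \<longrightarrow> pX $ j = 0) \<and>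
     (\<forall>x \<in> ilcs net. pX $ ilc_dc net x = - pX $ ilc_ac net x) \<and>
     (\<forall>j \<in> X_ac net. pG $ j = 0) \<and>
     (\<forall>j \<in> X_ac net. 0 = bus_surplus net \<eta> V pG j - pX $ j) \<and>
     pG = - (Q_tilde net Q *v droop_signal net m \<omega> V) + p_nom \<and>
     (\<forall>x \<in> ilcs net. \<omega> $ ilc_ac net x = m * V $ ilc_dc net x)"

text \<open>Solutions of the closed-loop differential-algebraic system on \<open>[0, \<infinity>)\<close>.\<close>

definition closed_loop_solution ::
  "('b::finite, 'x) hybrid_network \<Rightarrow> real^'b^'b \<Rightarrow> real^'b \<Rightarrow> real \<Rightarrow>
   (real \<Rightarrow> real^('b \<times> 'b)) \<Rightarrow> (real \<Rightarrow> real^'b) \<Rightarrow> (real \<Rightarrow> real^'b) \<Rightarrow>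
   (real \<Rightarrow> real^'b) \<Rightarrow> (real \<Rightarrow> real^'b) \<Rightarrow> bool" where
  "closed_loop_solution net Q p_nom m \<eta> \<omega> V pG pX \<longleftrightarrow>
     (\<forall>t\<ge>0.
        algebraic_relations net Q p_nom m (\<eta> t) (\<omega> t) (V t) (pG t) (pX t) \<and>
        (\<forall>(i, j) \<in> E_ac net.
           ((\<lambda>s. \<eta> s $ (i, j)) has_real_derivative \<omega> t $ i - \<omega> t $ j) (at t within {0..})) \<and>
        (\<forall>j \<in> N_ac net - X_ac net.
           ((\<lambda>s. inertia net j * \<omega> s $ j) has_real_derivative
              bus_surplus net (\<eta> t) (V t) (pG t) j - damping net j * \<omega> t $ j) (at t within {0..})) \<and>
        (\<forall>j \<in> N_dc net.
           ((\<lambda>s. capacitance net j * V s $ j) has_real_derivative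
              bus_surplus net (\<eta> t) (V t) (pG t) j - pX t $ j) (at t within {0..})))"

definition closed_loop_equilibrium ::
  "('b::finite, 'x) hybrid_network \<Rightarrow> real^'b^'b \<Rightarrow> real^'b \<Rightarrow> real \<Rightarrow>
   real^('b \<times> 'b) \<Rightarrow> real^'b \<Rightarrow> real^'b \<Rightarrow> real^'b \<Rightarrow> real^'b \<Rightarrow> bool" where
  "closed_loop_equilibrium net Q p_nom m \<eta> \<omega> V pG pX \<longleftrightarrow>
     algebraic_relations net Q p_nom m \<eta> \<omega> V pG pX \<and>
     (\<forall>(i, j) \<in> E_ac net. 0 = \<omega> $ i - \<omega> $ j) \<and>
     (\<forall>j \<in> N_ac net - X_ac net. 0 = bus_surplus net \<eta> V pG j - damping net j * \<omega> $ j) \<and>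
     (\<forall>j \<in> N_dc net. 0 = bus_surplus net \<eta> V pG j - pX $ j)"

text \<open>State coordinates \<open>(\<eta>, \<omega>\<^sup>G, V)\<close>: the coordinates of \<open>\<eta>\<close>, \<open>\<omega>\<close>, \<open>V\<close> outside \<open>E\<^sub>a\<^sub>c\<close>,
  \<open>N\<^sub>a\<^sub>c - X\<^sub>a\<^sub>c\<close>, \<open>N\<^sub>d\<^sub>c\<close> are not part of the state and are set to \<open>0\<close>. The state space is thus the
  coordinate subspace with these coordinates, carrying its Euclidean topology.\<close>

type_synonym 'b state = "(real^('b \<times> 'b)) \<times> (real^'b) \<times> (real^'b)"

definition restrict_coords :: "'n set \<Rightarrow> real^'n \<Rightarrow> real^'n" where
  "restrict_coords A v = (\<chi> i. if i \<in> A then v $ i else 0)"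

definition state_of ::
  "('b::finite, 'x) hybrid_network \<Rightarrow> real^('b \<times> 'b) \<Rightarrow> real^'b \<Rightarrow> real^'b \<Rightarrow> 'b state" where
  "state_of net \<eta> \<omega> V = (restrict_coords (E_ac net) \<eta>,
     restrict_coords (N_ac net - X_ac net) \<omega>, restrict_coords (N_dc net) V)"

definition state_space :: "('b::finite, 'x) hybrid_network \<Rightarrow> 'b state set" where
  "state_space net = {state_of net \<eta> \<omega> V | \<eta> \<omega> V. True}"

definition equilibrium_set ::
  "('b::finite, 'x) hybrid_network \<Rightarrow> real^'b^'b \<Rightarrow> real^'b \<Rightarrow> real \<Rightarrow> 'b state set" where
  "equilibrium_set net Q p_nom m =
     {state_of net \<eta> \<omega> V | \<eta> \<omega> V. \<exists>pG pX. closed_loop_equilibrium net Q p_nom m \<eta> \<omega> V pG pX}"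

end

theory Submission
  imports Defs
begin

text \<open>The converter variables can be eliminated, so solutions follow a continuous vector field on the
  state space. Take the kinetic energy, the capacitor energy weighted by \<open>m\<close> and the Bregman
  potential of the AC lines, all relative to the given equilibrium. Along every solution this energy
  decreases at a rate that vanishes only where \<open>\<omega>\<close> and \<open>V\<close> have their equilibrium values, and since
  \<open>\<bar>\<eta>\<^sup>*\<bar> < \<pi>/2\<close> the equilibrium is a strict local minimum of it. Hence solutions that start close by
  stay in a compact set. Instead of LaSalle's principle, Barbalat's lemma is applied twice: to the
  energy, which shows that \<open>\<omega>\<close> and \<open>V\<close> converge, and then to \<open>\<omega>\<close> and \<open>V\<close>, which shows that their
  derivatives tend to \<open>0\<close>. The points where both the dissipation and these derivatives vanish are
  equilibria, and compactness turns this into convergence to the equilibrium set.\<close>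

section \<open>Attraction from a strict Lyapunov function\<close>

text \<open>If \<open>g'\<close> were large at a late time, uniform continuity would keep it nearly
  constant on a window of fixed length, and \<open>g\<close> would change there by a fixed amount,
  which its convergence forbids.\<close>

lemma barbalat:
  fixes g g' :: "real \<Rightarrow> 'a::real_normed_vector"
  assumes der: "\<And>t. t \<ge> 0 \<Longrightarrow> (g has_vector_derivative g' t) (at t within {0..})"
    and lim: "(g \<longlongrightarrow> L) at_top"
    and uc: "uniformly_continuous_on {0..} g'"
  shows "(g' \<longlongrightarrow> 0) at_top"
proof (rule tendstoI)
  fix e :: real assume e: "e > 0"
  obtain d where d: "d > 0" and
    d': "\<And>s t. s \<ge> 0 \<Longrightarrow> t \<ge> 0 \<Longrightarrow> dist s t < d \<Longrightarrow> dist (g' s) (g' t) < e / 3"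
    using uc e unfolding uniformly_continuous_on_def
    by (metis atLeast_iff divide_pos_pos zero_less_numeral)
  \<comment> \<open>Half the modulus \<open>d\<close>, so that the closed window of length
    \<open>h\<close> lies inside it. A variation of \<open>g\<close> below \<open>h * e / 3\<close>
    and a linearization error of at most \<open>h * e / 3\<close> then leave
    \<open>h * norm (g' t) < h * e\<close>.\<close>
  define h where "h = d / 2"
  have h: "h > 0" "h < d" using d by (auto simp: h_def)
  have "\<forall>\<^sub>F t in at_top. dist (g t) L < h * e / 6"
    using lim h e by (intro tendstoD) auto
  then obtain T where T: "\<And>t. t \<ge> T \<Longrightarrow> dist (g t) L < h * e / 6"
    by (auto simp: eventually_at_top_linorder)
  show "\<forall>\<^sub>F t in at_top. dist (g' t) 0 < e"
    unfolding eventually_at_top_linorder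
  proof (intro exI allI impI)
    fix t assume t: "t \<ge> max 0 T"
    have "norm (g (t + h) - g t - (t + h - t) *\<^sub>R g' t) \<le> norm (t + h - t) * (e / 3)"
    proof (rule vector_differentiable_bound_linearization)
      show "(g has_vector_derivative g' s) (at s within {t..t + h})" if "s \<in> {t..t + h}" for s
        using that t by (intro has_vector_derivative_within_subset[OF der]) auto
      show "norm (g' s - g' t) \<le> e / 3" if "s \<in> {t..t + h}" for s
        using d'[of s t] that t h by (auto simp: dist_norm)
    qed (use t h in \<open>auto simp: closed_segment_eq_real_ivl\<close>)
    then have 1: "norm (g (t + h) - g t - h *\<^sub>R g' t) \<le> h * (e / 3)"
      using h by simp
    have "dist (g (t + h)) (g t) < h * e / 6 + h * e / 6"
      using T[of t] T[of "t + h"] t h by (intro dist_triangle_less_add[of _ L]) (auto simp: dist_commute)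
    then have 2: "norm (g (t + h) - g t) < h * e / 3"
      by (simp add: dist_norm mult.commute)
    have "norm (h *\<^sub>R g' t) \<le> norm (g (t + h) - g t) + norm (g (t + h) - g t - h *\<^sub>R g' t)"
      using norm_triangle_ineq4[of "g (t + h) - g t" "g (t + h) - g t - h *\<^sub>R g' t"] by simp
    moreover have "norm (h *\<^sub>R g' t) = h * norm (g' t)" "h * e > 0" using h e by auto
    ultimately have "h * norm (g' t) < h * e"
      using 1 2 by linarith
    then show "dist (g' t) 0 < e" using h by simp
  qed
qed

text \<open>On the compact part of \<open>K\<close> where \<open>\<bar>g\<bar>\<close> is at least
  \<open>e\<close>, \<open>f\<close> has no zero, so \<open>\<bar>f\<bar>\<close> has a positive
  minimum there. Once \<open>\<bar>f (x t)\<bar>\<close> is below this minimum, \<open>x t\<close>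
  is outside that part.\<close>

lemma tendsto_zero_of_zeros_subset:
  fixes f g :: "'a::t2_space \<Rightarrow> real"
  assumes K: "compact K" and f: "continuous_on K f" and g: "continuous_on K g"
    and zeros: "\<And>y. y \<in> K \<Longrightarrow> f y = 0 \<Longrightarrow> g y = 0"
    and x: "\<forall>\<^sub>F t in F. x t \<in> K" and lim: "((\<lambda>t. f (x t)) \<longlongrightarrow> 0) F"
  shows "((\<lambda>t. g (x t)) \<longlongrightarrow> 0) F"
proof (rule tendstoI)
  fix e :: real assume e: "e > 0"
  define K' where "K' = {y \<in> K. \<bar>g y\<bar> \<in> {e..}}"
  have "compact K'"
  proof (rule closedin_compact[OF K])
    have "closedin (top_of_set K) (K \<inter> (\<lambda>y. \<bar>g y\<bar>) -` {e..})"
      by (intro continuous_closedin_preimage continuous_intros g)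
    then show "closedin (top_of_set K) K'"
      by (simp add: K'_def vimage_def Int_def)
  qed
  show "\<forall>\<^sub>F t in F. dist (g (x t)) 0 < e"
  proof (cases "K' = {}")
    case True
    show ?thesis using x by eventually_elim (use True in \<open>auto simp: K'_def not_le\<close>)
  next
    case False
    have "continuous_on K' (\<lambda>y. \<bar>f y\<bar>)"
      by (intro continuous_intros continuous_on_subset[OF f]) (auto simp: K'_def)
    from continuous_attains_inf[OF \<open>compact K'\<close> False this]
    obtain z where z: "z \<in> K'" and min: "\<And>y. y \<in> K' \<Longrightarrow> \<bar>f z\<bar> \<le> \<bar>f y\<bar>" by blast
    have "f z \<noteq> 0" using z zeros[of z] e by (auto simp: K'_def)
    then have "\<forall>\<^sub>F t in F. dist (f (x t)) 0 < \<bar>f z\<bar>"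
      using lim by (intro tendstoD) auto
    then show ?thesis using x
    proof eventually_elim
      case (elim t)
      then have "x t \<notin> K'" using min[of "x t"] by auto
      then show ?case using elim by (auto simp: K'_def)
    qed
  qed
qed

text \<open>The rate \<open>q\<close> need not separate points: its zeros fix only the part
  \<open>P y\<close> of the state. The other coordinates are handled by \<open>limit\<close>, which
  looks at the field where \<open>P y\<close> has stopped moving. The decay of \<open>W\<close> is
  required along each trajectory, so no gradient of \<open>W\<close> appears.\<close>

theorem lyapunov_attraction:
  fixes F :: "'a::euclidean_space \<Rightarrow> 'a" and W q :: "'a \<Rightarrow> real" and P :: "'a \<Rightarrow> 'c::real_normed_vector"
  assumes S: "closed S" "y0 \<in> S"
    and F: "continuous_on S F" and W: "continuous_on S W" and q: "continuous_on S q"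
    and q_nonneg: "\<And>y. y \<in> S \<Longrightarrow> q y \<ge> 0"
    and P: "bounded_linear P"
    and r: "r > 0"
    and W0: "W y0 = 0" and W_pos: "\<And>y. y \<in> S \<Longrightarrow> dist y0 y \<le> r \<Longrightarrow> y \<noteq> y0 \<Longrightarrow> W y > 0"
    and q_zero: "\<And>y. y \<in> S \<Longrightarrow> q y = 0 \<Longrightarrow> P y = P y0"
    and limit: "\<And>y. y \<in> S \<Longrightarrow> q y = 0 \<Longrightarrow> P (F y) = 0 \<Longrightarrow> y \<in> Eq"
  shows "\<exists>U. openin (top_of_set S) U \<and> y0 \<in> U \<and>
    (\<forall>x. (\<forall>t\<ge>0. x t \<in> S \<and> (x has_vector_derivative F (x t)) (at t within {0..}) \<and>
             ((\<lambda>s. W (x s)) has_real_derivative - q (x t)) (at t within {0..})) \<and> x 0 \<in> U \<longrightarrow>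
       ((\<lambda>t. infdist (x t) Eq) \<longlongrightarrow> 0) at_top)"
proof -
  define K where "K = S \<inter> cball y0 r"
  have K: "compact K" "K \<subseteq> S"
    using S by (auto simp: K_def closed_Int_compact)
  obtain a where a: "a > 0" and bd: "\<And>y. y \<in> S \<Longrightarrow> dist y0 y = r \<Longrightarrow> W y \<ge> a"
  proof (cases "S \<inter> sphere y0 r = {}")
    case True
    \<comment> \<open>If \<open>S\<close> misses the sphere, the bound on it is vacuous and any
      positive constant serves.\<close>
    show ?thesis by (rule that[of 1]) (use True in auto)
  next
    case False
    have "compact (S \<inter> sphere y0 r)" using S by (auto simp: closed_Int_compact)
    from continuous_attains_inf[OF this False continuous_on_subset[OF W]]
    obtain z where z: "z \<in> S" "dist y0 z = r" "\<And>y. y \<in> S \<Longrightarrow> dist y0 y = r \<Longrightarrow> W z \<le> W y"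
      by auto
    then show ?thesis using that[of "W z"] W_pos[of z] r by force
  qed
  \<comment> \<open>A trap: a trajectory starting here could leave the ball only through the sphere,
    where \<open>W\<close> is at least \<open>a\<close>, but \<open>W\<close> starts below
    \<open>a\<close> and never increases.\<close>
  define U where "U = S \<inter> ball y0 r \<inter> (S \<inter> W -` {..<a})"
  have "openin (top_of_set S) U"
    unfolding U_def by (intro openin_Int openin_open_Int continuous_openin_preimage_gen W) auto
  moreover have "y0 \<in> U" using S W0 a r by (simp add: U_def)
  moreover have "((\<lambda>t. infdist (x t) Eq) \<longlongrightarrow> 0) at_top"
    if x: "\<And>t. t \<ge> 0 \<Longrightarrow> x t \<in> S"
      and x': "\<And>t. t \<ge> 0 \<Longrightarrow> (x has_vector_derivative F (x t)) (at t within {0..})"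
      and W': "\<And>t. t \<ge> 0 \<Longrightarrow> ((\<lambda>s. W (x s)) has_real_derivative - q (x t)) (at t within {0..})"
      and x0: "x 0 \<in> U" for x
  proof -
    have contx: "continuous_on {0..} x"
      using x' by (auto simp: continuous_on_eq_continuous_within intro: has_vector_derivative_continuous)
    have contW: "continuous_on {0..} (\<lambda>t. W (x t))"
      using W' by (rule DERIV_continuous_on) auto
    have decr: "W (x t) \<le> W (x s)" if "0 \<le> s" "s \<le> t" for s t
    proof (rule DERIV_nonpos_imp_decreasing_open[OF \<open>s \<le> t\<close>])
      fix u assume "s < u" "u < t"
      then have "((\<lambda>s. W (x s)) has_real_derivative - q (x u)) (at u)"
        using W'[of u] that \<open>s < u\<close> at_within_interior[of u "{0..}"] by simp
      moreover have "- q (x u) \<le> 0" using x q_nonneg \<open>s < u\<close> that by auto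
      ultimately show "\<exists>y. ((\<lambda>s. W (x s)) has_real_derivative y) (at u) \<and> y \<le> 0" by blast
    qed (use that in \<open>auto intro: continuous_on_subset[OF contW]\<close>)
    have near: "dist y0 (x t) < r" if t: "t \<ge> 0" for t
    proof (rule ccontr)
      assume "\<not> dist y0 (x t) < r"
      moreover have "continuous_on {0..t} (\<lambda>s. dist y0 (x s))"
        by (intro continuous_intros continuous_on_subset[OF contx]) auto
      ultimately obtain s where s: "0 \<le> s" "s \<le> t" "dist y0 (x s) = r"
        using IVT'[of "\<lambda>s. dist y0 (x s)" 0 r t] x0 t by (auto simp: U_def)
      then have "a \<le> W (x s)" by (intro bd x)
      also have "\<dots> \<le> W (x 0)" using s by (intro decr) auto
      also have "\<dots> < a" using x0 by (auto simp: U_def)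
      finally show False by simp
    qed
    have xK: "x t \<in> K" if "t \<ge> 0" for t
      using near[OF that] x[OF that] by (auto simp: K_def)
    have evK: "\<forall>\<^sub>F t in at_top. x t \<in> K"
      using eventually_ge_at_top[of 0] by eventually_elim (rule xK)
    \<comment> \<open>The speed bound on \<open>K\<close> makes \<open>x\<close> Lipschitz. Hence
      every continuous function of \<open>x t\<close> is uniformly continuous in time, as both uses
      of \<open>barbalat\<close> require.\<close>
    have "bounded (F ` K)"
      using K F by (intro compact_imp_bounded compact_continuous_image continuous_on_subset[OF F]) auto
    then obtain B where B: "B > 0" "\<And>y. y \<in> K \<Longrightarrow> norm (F y) \<le> B"
      by (auto simp: bounded_pos)
    have lip: "norm (x s - x t) \<le> B * norm (s - t)" if "s \<ge> 0" "t \<ge> 0" for s t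
    proof (rule differentiable_bound[of "{0..}" x "\<lambda>t h. h *\<^sub>R F (x t)"])
      fix u :: real assume "u \<in> {0..}"
      then show "(x has_derivative (\<lambda>h. h *\<^sub>R F (x u))) (at u within {0..})"
        using x'[of u] by (simp add: has_vector_derivative_def)
      show "onorm (\<lambda>h. h *\<^sub>R F (x u)) \<le> B"
        using B(2)[OF xK[of u]] \<open>u \<in> {0..}\<close> by (intro onorm_le) (auto simp: mult.commute[of B] intro!: mult_left_mono)
    qed (use that in auto)
    have ucx: "uniformly_continuous_on {0..} x"
      unfolding uniformly_continuous_on_def
    proof (intro allI impI)
      fix e :: real assume "e > 0"
      have "dist (x s) (x t) < e" if "s \<ge> 0" "t \<ge> 0" "dist s t < e / B" for s t
      proof -
        have "B * norm (s - t) < e" using that B by (simp add: dist_norm field_simps)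
        then show ?thesis using lip[of s t] that by (simp add: dist_norm)
      qed
      then show "\<exists>d>0. \<forall>t\<in>{0..}. \<forall>s\<in>{0..}. dist s t < d \<longrightarrow> dist (x s) (x t) < e"
        using \<open>e > 0\<close> B by (intro exI[of _ "e / B"]) auto
    qed
    have uc: "uniformly_continuous_on {0..} (\<lambda>t. f (x t))"
      if "continuous_on S f" for f :: "'a \<Rightarrow> 'd::metric_space"
    proof -
      have "uniformly_continuous_on K f"
        using K that by (blast intro: compact_uniformly_continuous continuous_on_subset)
      then have "uniformly_continuous_on (x ` {0..}) f"
        unfolding uniformly_continuous_on_def using xK by (metis (no_types, lifting) atLeast_iff imageE)
      from uniformly_continuous_on_compose[OF ucx this] show ?thesis .
    qed
    have "\<exists>L. ((\<lambda>t. W (x t)) \<longlongrightarrow> L) at_top"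
    proof -
      \<comment> \<open>Positivity inside the ball bounds the nonincreasing function
        \<open>W (x t)\<close> below, so it converges to its infimum.\<close>
      have W_nonneg: "W (x t) \<ge> 0" if "t \<ge> 0" for t
        using W_pos[OF x[OF that] less_imp_le[OF near[OF that]]] W0 by fastforce
      then have bdd: "bdd_below ((\<lambda>t. W (x t)) ` {0..})" by (auto intro!: bdd_belowI2)
      have "((\<lambda>t. W (x t)) \<longlongrightarrow> (INF t\<in>{0..}. W (x t))) at_top"
      proof (rule decreasing_tendsto)
        show "\<forall>\<^sub>F t in at_top. (INF t\<in>{0..}. W (x t)) \<le> W (x t)"
          using eventually_ge_at_top[of 0] by eventually_elim (auto intro: cINF_lower[OF bdd])
        fix y assume "(INF t\<in>{0..}. W (x t)) < y"
        then obtain s where s: "s \<ge> 0" "W (x s) < y"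
          using cINF_less_iff[OF _ bdd] by fastforce
        show "\<forall>\<^sub>F t in at_top. W (x t) < y"
          using eventually_ge_at_top[of s] by eventually_elim (use decr s in force)
      qed
      then show ?thesis by blast
    qed
    then obtain L where "((\<lambda>t. W (x t)) \<longlongrightarrow> L) at_top" ..
    \<comment> \<open>First use of \<open>barbalat\<close>: \<open>W (x t)\<close> converges and has
      derivative \<open>- q (x t)\<close>.\<close>
    then have "((\<lambda>t. - q (x t)) \<longlongrightarrow> 0) at_top"
      using W' by (intro barbalat[of "\<lambda>t. W (x t)"] uc continuous_intros q)
                  (auto simp: has_real_derivative_iff_has_vector_derivative)
    then have qx: "((\<lambda>t. q (x t)) \<longlongrightarrow> 0) at_top"
      using tendsto_minus_cancel[of "\<lambda>t. q (x t)" 0] by simp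
    have contP: "continuous_on A (\<lambda>y. P (f y))" if "continuous_on A f" for A f
      using bounded_linear.continuous_on[OF P that] .
    have "((\<lambda>t. norm (P (x t) - P y0)) \<longlongrightarrow> 0) at_top"
      by (rule tendsto_zero_of_zeros_subset[OF K(1) _ _ _ evK qx])
         (use K q_zero in \<open>auto intro!: continuous_intros contP continuous_on_subset[OF q]\<close>)
    then have "((\<lambda>t. P (x t)) \<longlongrightarrow> P y0) at_top"
      by (simp add: tendsto_norm_zero_iff LIM_zero_iff)
    \<comment> \<open>Second use of \<open>barbalat\<close>: \<open>P (x t)\<close> converges and,
      \<open>P\<close> being linear, has derivative \<open>P (F (x t))\<close>.\<close>
    then have "((\<lambda>t. P (F (x t))) \<longlongrightarrow> 0) at_top"
      by (intro barbalat[of "\<lambda>t. P (x t)"] uc contP F bounded_linear.has_vector_derivative[OF P] x')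
    \<comment> \<open>Both summands are nonnegative, so the sum vanishes only where both do, and
      such points of \<open>S\<close> lie in \<open>Eq\<close> by \<open>limit\<close>.\<close>
    from tendsto_add[OF qx tendsto_norm[OF this]]
    have sum0: "((\<lambda>t. q (x t) + norm (P (F (x t)))) \<longlongrightarrow> 0) at_top" by simp
    show ?thesis
    proof (rule tendsto_zero_of_zeros_subset[OF K(1) _ _ _ evK sum0])
      show "continuous_on K (\<lambda>y. q y + norm (P (F y)))"
        by (intro continuous_intros contP continuous_on_subset[OF q K(2)] continuous_on_subset[OF F K(2)])
      show "infdist y Eq = 0" if "y \<in> K" "q y + norm (P (F y)) = 0" for y
      proof -
        have "y \<in> S" using that K by auto
        then have "q y = 0 \<and> P (F y) = 0"
          using q_nonneg[of y] that(2) norm_ge_zero[of "P (F y)"] by (auto simp: add_nonneg_eq_0_iff)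
        then show ?thesis using limit \<open>y \<in> S\<close> by simp
      qed
    qed (intro continuous_intros)
  qed
  ultimately show ?thesis by blast
qed

section \<open>The network as an ordinary differential equation\<close>

lemma has_vector_derivative_vec:
  fixes f :: "real \<Rightarrow> real^'n"
  assumes "\<And>i. ((\<lambda>t. f t $ i) has_real_derivative f' $ i) (at t within S)"
  shows "(f has_vector_derivative f') (at t within S)"
  unfolding has_vector_derivative_def
proof (subst has_derivative_componentwise_within, rule ballI)
  fix b :: "real^'n" assume "b \<in> Basis"
  then obtain i where b: "b = axis i 1" by (auto simp: Basis_vec_def)
  have "(\<lambda>h. h * f' $ i) = (*) (f' $ i)" by (auto simp: mult.commute)
  then show "((\<lambda>t. f t \<bullet> b) has_derivative (\<lambda>h. (h *\<^sub>R f') \<bullet> b)) (at t within S)"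
    using assms[of i] by (simp add: b inner_axis has_field_derivative_def)
qed

text \<open>The expression is the integral of \<open>sin \<theta> - sin a\<close> from
  \<open>a\<close> to \<open>b\<close>, and \<open>sin\<close> is strictly increasing on the
  interval from \<open>- pi / 2\<close> to \<open>pi / 2\<close>. It makes the potential of an AC
  line positive away from the equilibrium angle.\<close>

lemma cos_tangent_gap:
  fixes a b :: real
  assumes "\<bar>a\<bar> < pi / 2" "\<bar>b\<bar> \<le> pi / 2" "a \<noteq> b"
  shows "cos a - cos b - (b - a) * sin a > 0"
proof -
  have deriv: "(cos has_real_derivative - sin c) (at c)" for c :: real
    by (auto intro!: derivative_eq_intros)
  consider "a < b" | "b < a" using assms by linarith
  then show ?thesis
  proof cases
    case 1
    obtain c where c: "a < c" "c < b" "cos b - cos a = (b - a) * - sin c"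
      using MVT2[OF 1 deriv] by blast
    have "sin a < sin c" using c assms by (intro sin_monotone_2pi) auto
    with 1 have "(b - a) * (sin c - sin a) > 0" by simp
    with c show ?thesis by (simp add: algebra_simps)
  next
    case 2
    obtain c where c: "b < c" "c < a" "cos a - cos b = (a - b) * - sin c"
      using MVT2[OF 2 deriv] by blast
    have "sin c < sin a" using c assms by (intro sin_monotone_2pi) auto
    with 2 have "(a - b) * (sin a - sin c) > 0" by simp
    with c show ?thesis by (simp add: algebra_simps)
  qed
qed

text \<open>Summation by parts on the graph: the flow on a line enters the balance of its head with
  a plus sign and that of its tail with a minus sign.\<close>

lemma sum_mult_net_inflow:
  fixes net :: "('b::finite, 'x) hybrid_network"
  shows "(\<Sum>j\<in>UNIV. u j * net_inflow net p j) = (\<Sum>(i, j)\<in>lines net. p (i, j) * (u j - u i))"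
proof -
  let ?L = "lines net"
  \<comment> \<open>Line sums become double sums over all buses with an indicator, so that the order
    of summation can be swapped.\<close>
  have edges: "(\<Sum>(i, j)\<in>?L. g i j) = (\<Sum>i\<in>UNIV. \<Sum>j\<in>UNIV. if (i, j) \<in> ?L then g i j else 0)"
    for g :: "'b \<Rightarrow> 'b \<Rightarrow> real"
  proof -
    have "(\<Sum>(i, j)\<in>?L. g i j) = (\<Sum>(i, j)\<in>UNIV. if (i, j) \<in> ?L then g i j else 0)"
      by (rule sum.mono_neutral_cong_left) auto
    then show ?thesis by (simp add: sum.cartesian_product UNIV_Times_UNIV[symmetric] del: UNIV_Times_UNIV)
  qed
  have "(\<Sum>j\<in>UNIV. u j * net_inflow net p j) =
      (\<Sum>j\<in>UNIV. \<Sum>i\<in>UNIV. if (i, j) \<in> ?L then p (i, j) * u j else 0) -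
      (\<Sum>j\<in>UNIV. \<Sum>k\<in>UNIV. if (j, k) \<in> ?L then p (j, k) * u j else 0)"
    by (simp add: net_inflow_def right_diff_distrib sum_subtractf sum_distrib_left sum.If_cases
        mult.commute)
  also have "\<dots> = (\<Sum>(i, j)\<in>?L. p (i, j) * u j) - (\<Sum>(i, j)\<in>?L. p (i, j) * u i)"
    by (subst sum.swap) (simp add: edges)
  also have "\<dots> = (\<Sum>(i, j)\<in>?L. p (i, j) * (u j - u i))"
    by (simp add: sum_subtractf[symmetric] case_prod_unfold right_diff_distrib)
  finally show ?thesis .
qed

lemma restrict_coords_nth [simp]: "restrict_coords A v $ i = (if i \<in> A then v $ i else 0)"
  by (simp add: restrict_coords_def)

lemma positive_definite_diagonal:
  fixes Q :: "real^'n^'n"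
  assumes "positive_definite Q"
  shows "Q $ j $ j > 0"
proof -
  have "axis j 1 \<bullet> (Q *v axis j 1) > 0"
    using assms by (simp add: positive_definite_def axis_eq_0_iff)
  then show ?thesis by (simp add: inner_axis' matrix_vector_mul_component inner_axis)
qed

lemma Q_tilde_mult_nth:
  fixes net :: "('b::finite, 'x) hybrid_network"
  shows "(Q_tilde net Q *v v) $ j = (if j \<in> X_ac net then 0 else inverse (Q $ j $ j) * v $ j)"
proof -
  have "(Q_tilde net Q *v v) $ j =
      (\<Sum>k\<in>UNIV. if k = j then if j \<in> X_ac net then 0 else inverse (Q $ j $ j) * v $ j else 0)"
    by (subst matrix_vector_mul_component) (unfold inner_vec_def Q_tilde_def, intro sum.cong, auto)
  then show ?thesis by simp
qed

text \<open>The condition \<open>b\<close> does not depend on \<open>y\<close>, so no matching of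
  the branches is required. It serves the case distinctions on the kind of bus or line.\<close>

lemma continuous_on_if_const:
  assumes "b \<Longrightarrow> continuous_on S f" "\<not> b \<Longrightarrow> continuous_on S g"
  shows "continuous_on S (\<lambda>y. if b then f y else g y)"
  using assms by (cases b) auto

section \<open>Elimination of the algebraic variables\<close>

locale hybrid_loop =
  fixes net :: "('b::finite, 'x) hybrid_network"
    and Q :: "real^'b^'b" and p_nom :: "real^'b" and m :: real
  assumes network: "valid_network net"
    and Q_pos: "\<And>j. Q $ j $ j > 0"
    and p_nom_X: "\<And>j. j \<in> X_ac net \<Longrightarrow> p_nom $ j = 0"
    and m_pos: "m > 0"
begin

abbreviation "N_gen \<equiv> N_ac net - X_ac net"

lemma dc_notin_ac: "j \<in> N_dc net \<Longrightarrow> j \<notin> N_ac net"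
  and bus_cases: "j \<in> N_ac net \<or> j \<in> N_dc net"
  and X_subset: "X_ac net \<subseteq> N_ac net" "X_dc net \<subseteq> N_dc net"
  and lines_eq: "lines net = E_ac net \<union> E_dc net"
  and ilcs: "finite (ilcs net)" "inj_on (ilc_ac net) (ilcs net)" "inj_on (ilc_dc net) (ilcs net)"
  using network unfolding valid_network_def by blast+

lemma parameters_pos:
  "j \<in> N_gen \<Longrightarrow> inertia net j > 0" "j \<in> N_gen \<Longrightarrow> damping net j > 0"
  "j \<in> N_dc net \<Longrightarrow> capacitance net j > 0"
  "e \<in> E_ac net \<Longrightarrow> susceptance net e > 0"
  "e \<in> E_dc net \<Longrightarrow> conductance net e > 0"
  using network unfolding valid_network_def conductance_def by auto

lemma parameters_nonzero:
  "j \<in> N_ac net \<Longrightarrow> j \<notin> X_ac net \<Longrightarrow> inertia net j \<noteq> 0"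
  "j \<in> N_dc net \<Longrightarrow> capacitance net j \<noteq> 0"
  using parameters_pos(1,3)[of j] by auto

lemma line_ends:
  "(i, j) \<in> E_ac net \<Longrightarrow> i \<in> N_ac net" "(i, j) \<in> E_ac net \<Longrightarrow> j \<in> N_ac net"
  "(i, j) \<in> E_dc net \<Longrightarrow> i \<in> N_dc net" "(i, j) \<in> E_dc net \<Longrightarrow> j \<in> N_dc net"
  by (auto simp: E_ac_def E_dc_def N_ac_def N_dc_def)

lemma E_disjoint: "E_ac net \<inter> E_dc net = {}"
  using line_ends dc_notin_ac by fastforce

lemma ilc_ends:
  assumes "x \<in> ilcs net"
  shows "ilc_ac net x \<in> X_ac net" "ilc_dc net x \<in> X_dc net"
    "ilc_ac net x \<in> N_ac net" "ilc_dc net x \<in> N_dc net"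
  using assms X_subset by (auto simp: X_ac_def X_dc_def)

text \<open>By injectivity \<open>inv_into\<close> recovers the only converter at a bus. At a bus
  without a converter of the relevant side the value is arbitrary; \<open>dc_end\<close> is
  evaluated only on \<open>X_ac\<close> and \<open>ac_end\<close> only on
  \<open>X_dc\<close>.\<close>

definition dc_end :: "'b \<Rightarrow> 'b" where
  "dc_end j = ilc_dc net (inv_into (ilcs net) (ilc_ac net) j)"

definition ac_end :: "'b \<Rightarrow> 'b" where
  "ac_end j = ilc_ac net (inv_into (ilcs net) (ilc_dc net) j)"

lemma other_end:
  assumes "x \<in> ilcs net"
  shows "dc_end (ilc_ac net x) = ilc_dc net x" "ac_end (ilc_dc net x) = ilc_ac net x"
  using assms ilcs by (simp_all add: dc_end_def ac_end_def)

text \<open>The frequency at the AC side of a converter is not a state: the converter control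
  dictates it through the DC voltage.\<close>

definition frequency :: "real^'b \<Rightarrow> real^'b \<Rightarrow> real^'b" where
  "frequency \<omega> V = (\<chi> j. if j \<in> X_ac net then m * V $ dc_end j else \<omega> $ j)"

definition generation :: "real^'b \<Rightarrow> real^'b \<Rightarrow> real^'b" where
  "generation \<omega> V = - (Q_tilde net Q *v droop_signal net m (frequency \<omega> V) V) + p_nom"

definition surplus :: "real^('b \<times> 'b) \<Rightarrow> real^'b \<Rightarrow> real^'b \<Rightarrow> 'b \<Rightarrow> real" where
  "surplus \<eta> \<omega> V j = bus_surplus net \<eta> V (generation \<omega> V) j"

text \<open>An AC converter bus has no inertia, so its whole surplus must leave through the
  converter; losslessness then gives the DC side.\<close>

definition ilc_power :: "real^('b \<times> 'b) \<Rightarrow> real^'b \<Rightarrow> real^'b \<Rightarrow> real^'b" where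
  "ilc_power \<eta> \<omega> V = (\<chi> j. if j \<in> X_ac net then surplus \<eta> \<omega> V j
     else if j \<in> X_dc net then - surplus \<eta> \<omega> V (ac_end j) else 0)"

text \<open>The vector field obtained by eliminating the algebraic variables \<open>\<omega>\<close> on \<open>X\<^sub>a\<^sub>c\<close>, \<open>p\<^sup>G\<close>
  and \<open>p\<^sup>X\<close>.\<close>

definition field :: "'b state \<Rightarrow> 'b state" where
  "field y = (let \<eta> = fst y; \<omega> = fst (snd y); V = snd (snd y) in
     (\<chi> e. if e \<in> E_ac net then frequency \<omega> V $ fst e - frequency \<omega> V $ snd e else 0,
      \<chi> j. if j \<in> N_gen then (surplus \<eta> \<omega> V j - damping net j * \<omega> $ j) / inertia net j else 0,
      \<chi> j. if j \<in> N_dc net then (surplus \<eta> \<omega> V j - ilc_power \<eta> \<omega> V $ j) / capacitance net j else 0))"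

lemma continuous_on_surplus:
  "continuous_on S (\<lambda>y. surplus (fst y) (fst (snd y)) (snd (snd y)) j)"
  unfolding surplus_def bus_surplus_def net_inflow_def line_power_def generation_def frequency_def
    droop_signal_def
  by (auto simp: Q_tilde_mult_nth
      intro!: continuous_intros continuous_on_if_const)

lemma continuous_on_field: "continuous_on S field"
  unfolding field_def Let_def ilc_power_def frequency_def
  by (auto intro!: continuous_intros continuous_on_if_const continuous_on_surplus
      dest: parameters_nonzero)

text \<open>The algebraic variables are functions of the state. Restriction forgets
  \<open>\<omega>\<close> on \<open>X_ac\<close>, but the converter control restores it from
  \<open>V\<close>; the droop signal, generation, line flows and converter powers then agree in
  turn.\<close>

lemma algebraic_relations_eliminated:
  assumes rel: "algebraic_relations net Q p_nom m \<eta> \<omega> V pG pX"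
    and y: "state_of net \<eta> \<omega> V = (\<eta>', \<omega>', V')"
  shows "j \<in> N_ac net \<Longrightarrow> frequency \<omega>' V' $ j = \<omega> $ j"
    and "surplus \<eta>' \<omega>' V' j = bus_surplus net \<eta> V pG j"
    and "ilc_power \<eta>' \<omega>' V' = pX"
proof -
  have y': "\<eta>' = restrict_coords (E_ac net) \<eta>" "\<omega>' = restrict_coords N_gen \<omega>"
      "V' = restrict_coords (N_dc net) V"
    using y by (auto simp: state_of_def)
  have freq: "frequency \<omega>' V' $ j = \<omega> $ j" if "j \<in> N_ac net" for j
  proof (cases "j \<in> X_ac net")
    case True
    then obtain x where "x \<in> ilcs net" "j = ilc_ac net x" by (auto simp: X_ac_def)
    then show ?thesis
      using rel True by (simp add: frequency_def y' other_end ilc_ends algebraic_relations_def)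
  qed (use that in \<open>simp add: frequency_def y'\<close>)
  have "droop_signal net m (frequency \<omega>' V') V' = droop_signal net m \<omega> V"
    using freq bus_cases by (auto simp: droop_signal_def vec_eq_iff y')
  then have gen: "generation \<omega>' V' = pG"
    using rel by (simp add: generation_def algebraic_relations_def)
  have "line_power net \<eta>' V' e = line_power net \<eta> V e" if "e \<in> lines net" for e
    using that line_ends by (auto simp: line_power_def y' lines_eq split: prod.splits)
  then have "net_inflow net (line_power net \<eta>' V') j = net_inflow net (line_power net \<eta> V) j" for j
    unfolding net_inflow_def by (auto intro!: arg_cong2[where f = "(-)"] sum.cong)
  then have sur: "surplus \<eta>' \<omega>' V' j = bus_surplus net \<eta> V pG j" for j
    by (simp add: surplus_def bus_surplus_def gen)
  have "ilc_power \<eta>' \<omega>' V' $ j = pX $ j" for j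
  proof -
    have ac: "bus_surplus net \<eta> V pG k = pX $ k" if "k \<in> X_ac net" for k
      using rel that by (auto simp: algebraic_relations_def)
    consider "j \<in> X_ac net" | x where "x \<in> ilcs net" "j = ilc_dc net x"
      | "j \<notin> X_ac net" "j \<notin> X_dc net" by (auto simp: X_dc_def)
    then show ?thesis
    proof cases
      case 1
      then show ?thesis by (simp add: ilc_power_def sur ac)
    next
      case 2
      then have "j \<notin> X_ac net" "j \<in> X_dc net" "pX $ j = - pX $ ilc_ac net x"
        using ilc_ends X_subset dc_notin_ac rel by (auto simp: algebraic_relations_def)
      with 2 show ?thesis by (simp add: ilc_power_def sur ac other_end ilc_ends)
    next
      case 3
      then show ?thesis using rel by (simp add: ilc_power_def algebraic_relations_def)
    qed
  qed
  then have "ilc_power \<eta>' \<omega>' V' = pX" by (simp add: vec_eq_iff)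
  then show "j \<in> N_ac net \<Longrightarrow> frequency \<omega>' V' $ j = \<omega> $ j"
    and "surplus \<eta>' \<omega>' V' j = bus_surplus net \<eta> V pG j"
    and "ilc_power \<eta>' \<omega>' V' = pX"
    using freq sur by auto
qed

lemma solution_has_field_derivative:
  assumes sol: "closed_loop_solution net Q p_nom m \<eta> \<omega> V pG pX" and t: "t \<ge> 0"
  shows "((\<lambda>s. state_of net (\<eta> s) (\<omega> s) (V s)) has_vector_derivative
           field (state_of net (\<eta> t) (\<omega> t) (V t))) (at t within {0..})"
proof -
  obtain \<eta>' \<omega>' V' where y: "state_of net (\<eta> t) (\<omega> t) (V t) = (\<eta>', \<omega>', V')"
    using prod_cases3 by blast
  have rel: "algebraic_relations net Q p_nom m (\<eta> t) (\<omega> t) (V t) (pG t) (pX t)"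
    using sol t by (auto simp: closed_loop_solution_def)
  note elim = algebraic_relations_eliminated[OF rel y]
  have ang: "((\<lambda>s. \<eta> s $ (i, j)) has_real_derivative \<omega> t $ i - \<omega> t $ j) (at t within {0..})"
    if "(i, j) \<in> E_ac net" for i j
    using sol t that by (auto simp: closed_loop_solution_def)
  have fr: "((\<lambda>s. \<omega> s $ j) has_real_derivative
      (bus_surplus net (\<eta> t) (V t) (pG t) j - damping net j * \<omega> t $ j) / inertia net j)
      (at t within {0..})" if "j \<in> N_gen" for j
  proof -
    have "((\<lambda>s. inertia net j * \<omega> s $ j) has_real_derivative
        bus_surplus net (\<eta> t) (V t) (pG t) j - damping net j * \<omega> t $ j) (at t within {0..})"
      using sol t that by (auto simp: closed_loop_solution_def)
    from DERIV_cdivide[OF this, of "inertia net j"] show ?thesis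
      using parameters_nonzero(1)[of j] that by simp
  qed
  have vo: "((\<lambda>s. V s $ j) has_real_derivative
      (bus_surplus net (\<eta> t) (V t) (pG t) j - pX t $ j) / capacitance net j)
      (at t within {0..})" if "j \<in> N_dc net" for j
  proof -
    have "((\<lambda>s. capacitance net j * V s $ j) has_real_derivative
        bus_surplus net (\<eta> t) (V t) (pG t) j - pX t $ j) (at t within {0..})"
      using sol t that by (auto simp: closed_loop_solution_def)
    from DERIV_cdivide[OF this, of "capacitance net j"] show ?thesis
      using parameters_pos(3)[of j] that by simp
  qed
  have \<omega>': "\<omega>' $ j = \<omega> t $ j" if "j \<in> N_gen" for j
    using y that by (auto simp: state_of_def)
  show ?thesis
    unfolding y
    unfolding field_def Let_def state_of_def fst_conv snd_conv
  proof (intro has_vector_derivative_Pair has_vector_derivative_vec)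
    fix e :: "'b \<times> 'b"
    show "((\<lambda>s. restrict_coords (E_ac net) (\<eta> s) $ e) has_real_derivative
        (\<chi> e. if e \<in> E_ac net then frequency \<omega>' V' $ fst e - frequency \<omega>' V' $ snd e else 0) $ e)
        (at t within {0..})"
      using ang[of "fst e" "snd e"] line_ends[of "fst e" "snd e"] by (auto simp: elim(1))
  next
    fix j
    show "((\<lambda>s. restrict_coords N_gen (\<omega> s) $ j) has_real_derivative
        (\<chi> j. if j \<in> N_gen then (surplus \<eta>' \<omega>' V' j - damping net j * \<omega>' $ j) / inertia net j else 0) $ j)
        (at t within {0..})"
      using fr[of j] \<omega>'[of j] by (auto simp: elim(2))
    show "((\<lambda>s. restrict_coords (N_dc net) (V s) $ j) has_real_derivative
        (\<chi> j. if j \<in> N_dc net then (surplus \<eta>' \<omega>' V' j - ilc_power \<eta>' \<omega>' V' $ j) / capacitance net j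
          else 0) $ j) (at t within {0..})"
      using vo[of j] by (auto simp: elim(2,3))
  qed
qed

text \<open>The converse of the elimination: \<open>frequency\<close>, \<open>generation\<close> and
  \<open>ilc_power\<close> rebuild algebraic variables satisfying all relations, and a zero field
  supplies the remaining equations.\<close>

lemma field_zero_imp_equilibrium:
  assumes y: "y \<in> state_space net" and zero: "field y = 0"
  shows "y \<in> equilibrium_set net Q p_nom m"
proof -
  obtain \<eta>0 \<omega>0 V0 where y0: "y = state_of net \<eta>0 \<omega>0 V0" using y by (auto simp: state_space_def)
  obtain \<eta> \<omega> V where yy: "y = (\<eta>, \<omega>, V)" using prod_cases3 by blast
  let ?f = "frequency \<omega> V" and ?g = "generation \<omega> V" and ?p = "ilc_power \<eta> \<omega> V"
  have "y = state_of net \<eta> ?f V"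
    using y0 unfolding yy by (auto simp: state_of_def vec_eq_iff frequency_def)
  moreover have "closed_loop_equilibrium net Q p_nom m \<eta> ?f V ?g ?p"
  proof -
    have "?f $ i = ?f $ j" if "(i, j) \<in> E_ac net" for i j
    proof -
      have "fst (field y) $ (i, j) = 0" using zero by simp
      then show ?thesis using that by (simp add: field_def yy)
    qed
    moreover have "surplus \<eta> \<omega> V j = damping net j * \<omega> $ j" if "j \<in> N_gen" for j
    proof -
      have "fst (snd (field y)) $ j = 0" using zero by simp
      then show ?thesis using that parameters_pos(1)[of j] by (simp add: field_def yy)
    qed
    moreover have "surplus \<eta> \<omega> V j = ?p $ j" if "j \<in> N_dc net" for j
    proof -
      have "snd (snd (field y)) $ j = 0" using zero by simp
      then show ?thesis using that parameters_pos(3)[of j] by (simp add: field_def yy)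
    qed
    moreover have "?f $ j = \<omega> $ j" if "j \<in> N_gen" for j
      using that by (simp add: frequency_def)
    moreover have "algebraic_relations net Q p_nom m \<eta> ?f V ?g ?p"
      unfolding algebraic_relations_def
    proof (intro conjI allI ballI impI)
      fix x assume x: "x \<in> ilcs net"
      have "ilc_dc net x \<notin> X_ac net" using ilc_ends[OF x] X_subset dc_notin_ac by blast
      then show "?p $ ilc_dc net x = - ?p $ ilc_ac net x"
        using ilc_ends[OF x] other_end[OF x] by (simp add: ilc_power_def)
      show "?f $ ilc_ac net x = m * V $ ilc_dc net x"
        using ilc_ends[OF x] other_end[OF x] by (simp add: frequency_def)
    next
      fix j assume j: "j \<in> X_ac net"
      show "?g $ j = 0" using j by (simp add: generation_def Q_tilde_mult_nth p_nom_X)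
      show "0 = bus_surplus net \<eta> V ?g j - ?p $ j"
        using j by (simp add: ilc_power_def surplus_def)
    qed (simp_all add: ilc_power_def generation_def)
    ultimately show ?thesis
      by (auto simp: closed_loop_equilibrium_def surplus_def)
  qed
  ultimately show ?thesis unfolding equilibrium_set_def by blast
qed

end

section \<open>Energy and dissipation relative to an equilibrium\<close>

locale hybrid_loop_equilibrium = hybrid_loop net Q p_nom m
  for net :: "('b::finite, 'x) hybrid_network" and Q p_nom m +
  fixes \<eta>0 :: "real^('b \<times> 'b)" and \<omega>0 V0 pG0 pX0 :: "real^'b"
  assumes equilibrium: "closed_loop_equilibrium net Q p_nom m \<eta>0 \<omega>0 V0 pG0 pX0"
    and angles: "\<And>e. e \<in> E_ac net \<Longrightarrow> \<bar>\<eta>0 $ e\<bar> < pi / 2"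
begin

text \<open>The potential of a line is \<open>\<integral> B (sin \<theta> - sin \<eta>0) d\<theta>\<close>. The factor \<open>m\<close> at the DC buses makes the
  converter terms cancel: \<open>(\<omega> - \<omega>0) p\<^sup>X\<close> at the AC side against \<open>m (V - V0) p\<^sup>X\<close> at the DC side.\<close>

definition energy :: "'b state \<Rightarrow> real" where
  "energy y = (let \<eta> = fst y; \<omega> = fst (snd y); V = snd (snd y) in
     (\<Sum>e\<in>E_ac net. susceptance net e *
        (cos (\<eta>0 $ e) - cos (\<eta> $ e) - (\<eta> $ e - \<eta>0 $ e) * sin (\<eta>0 $ e))) +
     (\<Sum>j\<in>N_gen. inertia net j / 2 * (\<omega> $ j - \<omega>0 $ j)\<^sup>2) +
     m * (\<Sum>j\<in>N_dc net. capacitance net j / 2 * (V $ j - V0 $ j)\<^sup>2))"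

text \<open>The terms come from droop and damping at the AC buses without converter, droop at the DC
  buses and ohmic loss on the DC lines. In \<open>m\<^sup>2\<close> one factor stems from the droop
  signal \<open>mV\<close>, the other from the weight \<open>m\<close> of the capacitor
  energy.\<close>

definition dissipation :: "'b state \<Rightarrow> real" where
  "dissipation y = (let \<omega> = fst (snd y); V = snd (snd y) in
     (\<Sum>j\<in>N_gen. (inverse (Q $ j $ j) + damping net j) * (\<omega> $ j - \<omega>0 $ j)\<^sup>2) +
     (\<Sum>j\<in>N_dc net. inverse (Q $ j $ j) * m\<^sup>2 * (V $ j - V0 $ j)\<^sup>2) +
     m * (\<Sum>(i, j)\<in>E_dc net. conductance net (i, j) * ((V $ i - V0 $ i) - (V $ j - V0 $ j))\<^sup>2))"

section \<open>Continuity, definiteness and decay of the energy\<close>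

lemma continuous_on_energy: "continuous_on S energy"
  unfolding energy_def Let_def by (intro continuous_intros)

lemma continuous_on_dissipation: "continuous_on S dissipation"
  unfolding dissipation_def Let_def case_prod_unfold by (intro continuous_intros)

lemma energy_state_of:
  "energy (state_of net \<eta> \<omega> V) =
     (\<Sum>e\<in>E_ac net. susceptance net e *
        (cos (\<eta>0 $ e) - cos (\<eta> $ e) - (\<eta> $ e - \<eta>0 $ e) * sin (\<eta>0 $ e))) +
     (\<Sum>j\<in>N_gen. inertia net j / 2 * (\<omega> $ j - \<omega>0 $ j)\<^sup>2) +
     m * (\<Sum>j\<in>N_dc net. capacitance net j / 2 * (V $ j - V0 $ j)\<^sup>2)"
  by (simp add: energy_def state_of_def cong: sum.cong_simp)

lemma dissipation_state_of:
  "dissipation (state_of net \<eta> \<omega> V) =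
     (\<Sum>j\<in>N_gen. (inverse (Q $ j $ j) + damping net j) * (\<omega> $ j - \<omega>0 $ j)\<^sup>2) +
     (\<Sum>j\<in>N_dc net. inverse (Q $ j $ j) * m\<^sup>2 * (V $ j - V0 $ j)\<^sup>2) +
     m * (\<Sum>(i, j)\<in>E_dc net. conductance net (i, j) * ((V $ i - V0 $ i) - (V $ j - V0 $ j))\<^sup>2)"
proof -
  have "(\<Sum>(i, j)\<in>E_dc net. conductance net (i, j) *
          ((restrict_coords (N_dc net) V $ i - V0 $ i) - (restrict_coords (N_dc net) V $ j - V0 $ j))\<^sup>2) =
        (\<Sum>(i, j)\<in>E_dc net. conductance net (i, j) * ((V $ i - V0 $ i) - (V $ j - V0 $ j))\<^sup>2)"
    by (rule sum.cong) (auto simp: line_ends)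
  then show ?thesis
    by (simp add: dissipation_def state_of_def cong: sum.cong_simp)
qed

text \<open>All summands are nonnegative, those of the lines by \<open>cos_tangent_gap\<close>
  thanks to the angle bound; a sum that is not positive makes each vanish and forces the equilibrium
  state.\<close>

lemma energy_pos:
  assumes y: "y \<in> state_space net" "y \<noteq> state_of net \<eta>0 \<omega>0 V0"
    and le: "\<And>e. e \<in> E_ac net \<Longrightarrow> \<bar>fst y $ e\<bar> \<le> pi / 2"
  shows "energy y > 0"
proof (rule ccontr)
  obtain \<eta> \<omega> V where st: "y = state_of net \<eta> \<omega> V" using y by (auto simp: state_space_def)
  let ?gap = "\<lambda>e. cos (\<eta>0 $ e) - cos (\<eta> $ e) - (\<eta> $ e - \<eta>0 $ e) * sin (\<eta>0 $ e)"
  let ?a = "\<lambda>e. susceptance net e * ?gap e"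
  let ?b = "\<lambda>j. inertia net j / 2 * (\<omega> $ j - \<omega>0 $ j)\<^sup>2"
  let ?c = "\<lambda>j. capacitance net j / 2 * (V $ j - V0 $ j)\<^sup>2"
  have gap: "?gap e > 0" if "e \<in> E_ac net" "\<eta> $ e \<noteq> \<eta>0 $ e" for e
    using cos_tangent_gap[OF angles[OF that(1)], of "\<eta> $ e"] le[OF that(1)] that
    by (auto simp: st state_of_def)
  have gap0: "?gap e \<ge> 0" if "e \<in> E_ac net" for e
    using gap[OF that] by (cases "\<eta> $ e = \<eta>0 $ e") (simp_all add: less_imp_le)
  have a: "?a e \<ge> 0" if "e \<in> E_ac net" for e
    using gap0[OF that] parameters_pos(4)[OF that] by (simp add: less_imp_le)
  have b: "?b j \<ge> 0" if "j \<in> N_gen" for j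
    using parameters_pos(1)[OF that] by simp
  have c: "?c j \<ge> 0" if "j \<in> N_dc net" for j
    using parameters_pos(3)[OF that] by simp
  note sums = sum_nonneg[of "E_ac net" ?a, OF a] sum_nonneg[of N_gen ?b, OF b]
    sum_nonneg[of "N_dc net" ?c, OF c]
  assume "\<not> energy y > 0"
  then have "sum ?a (E_ac net) + sum ?b N_gen + m * sum ?c (N_dc net) \<le> 0"
    by (simp add: st energy_state_of)
  moreover have "m * sum ?c (N_dc net) \<ge> 0" using sums(3) m_pos by simp
  ultimately have "sum ?a (E_ac net) = 0" "sum ?b N_gen = 0" "m * sum ?c (N_dc net) = 0"
    using sums(1,2) by linarith+
  then have zero: "sum ?a (E_ac net) = 0" "sum ?b N_gen = 0" "sum ?c (N_dc net) = 0"
    using m_pos by simp_all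
  have "\<eta> $ e = \<eta>0 $ e" if "e \<in> E_ac net" for e
  proof -
    have "?a e = 0" using zero(1) a that by (subst (asm) sum_nonneg_eq_0_iff) auto
    then show ?thesis using gap[OF that] parameters_pos(4)[OF that] by force
  qed
  moreover have "\<omega> $ j = \<omega>0 $ j" if "j \<in> N_gen" for j
  proof -
    have "?b j = 0" using zero(2) b that by (subst (asm) sum_nonneg_eq_0_iff) auto
    then show ?thesis using parameters_pos(1)[OF that] by simp
  qed
  moreover have "V $ j = V0 $ j" if "j \<in> N_dc net" for j
  proof -
    have "?c j = 0" using zero(3) c that by (subst (asm) sum_nonneg_eq_0_iff) auto
    then show ?thesis using parameters_pos(3)[OF that] by simp
  qed
  ultimately have "y = state_of net \<eta>0 \<omega>0 V0"
    by (auto simp: st state_of_def vec_eq_iff)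
  with y show False by simp
qed

text \<open>The squares at the buses in \<open>N_gen\<close> and \<open>N_dc net\<close> have
  strictly positive coefficients, so zero dissipation fixes all frequencies and voltages of the
  state. The angles remain free.\<close>

lemma dissipation_nonneg: "dissipation y \<ge> 0"
  and dissipation_zeroD:
    "dissipation y = 0 \<Longrightarrow> j \<in> N_gen \<Longrightarrow> fst (snd y) $ j = \<omega>0 $ j"
    "dissipation y = 0 \<Longrightarrow> j \<in> N_dc net \<Longrightarrow> snd (snd y) $ j = V0 $ j"
proof -
  let ?\<omega> = "fst (snd y)" and ?V = "snd (snd y)"
  let ?a = "\<lambda>j. (inverse (Q $ j $ j) + damping net j) * (?\<omega> $ j - \<omega>0 $ j)\<^sup>2"
  let ?b = "\<lambda>j. inverse (Q $ j $ j) * m\<^sup>2 * (?V $ j - V0 $ j)\<^sup>2"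
  let ?c = "\<lambda>(i, j). conductance net (i, j) * ((?V $ i - V0 $ i) - (?V $ j - V0 $ j))\<^sup>2"
  have coeff: "inverse (Q $ j $ j) + damping net j > 0" if "j \<in> N_gen" for j
    using Q_pos[of j] parameters_pos(2)[OF that] by (simp add: add_pos_pos)
  have a: "?a j \<ge> 0" if "j \<in> N_gen" for j using coeff[OF that] by simp
  have b: "?b j \<ge> 0" for j using Q_pos[of j] by (simp add: less_imp_le)
  have c: "?c e \<ge> 0" if "e \<in> E_dc net" for e
    using parameters_pos(5)[OF that] by (auto split: prod.splits)
  have sums: "sum ?a N_gen \<ge> 0" "sum ?b (N_dc net) \<ge> 0" "m * sum ?c (E_dc net) \<ge> 0"
    using sum_nonneg[of N_gen ?a, OF a] sum_nonneg[of "N_dc net" ?b, OF b]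
      sum_nonneg[of "E_dc net" ?c, OF c] m_pos by (simp_all only: mult_nonneg_nonneg less_imp_le)
  have eq: "dissipation y = sum ?a N_gen + sum ?b (N_dc net) + m * sum ?c (E_dc net)"
    by (simp add: dissipation_def Let_def)
  show "dissipation y \<ge> 0" using sums eq by linarith
  assume "dissipation y = 0"
  then have zero: "sum ?a N_gen = 0" "sum ?b (N_dc net) = 0" using sums eq by linarith+
  show "?\<omega> $ j = \<omega>0 $ j" if "j \<in> N_gen"
  proof -
    have "?a j = 0" using zero(1) a that by (subst (asm) sum_nonneg_eq_0_iff) auto
    then show ?thesis using coeff[OF that] by simp
  qed
  show "?V $ j = V0 $ j" if "j \<in> N_dc net"
  proof -
    have "?b j = 0" using zero(2) b that by (subst (asm) sum_nonneg_eq_0_iff) auto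
    then show ?thesis using Q_pos[of j] m_pos by simp
  qed
qed

text \<open>The left side is the rate of change of the energy. The bus balances, minus their
  equilibrium versions, are multiplied by the deviation \<open>u\<close> of the stacked signal and
  summed over all buses; AC line and converter terms cancel.\<close>

lemma power_balance:
  assumes rel: "algebraic_relations net Q p_nom m \<eta> \<omega> V pG pX"
  shows "(\<Sum>e\<in>E_ac net. susceptance net e * (sin (\<eta> $ e) - sin (\<eta>0 $ e)) * (\<omega> $ fst e - \<omega> $ snd e)) +
     (\<Sum>j\<in>N_gen. (\<omega> $ j - \<omega>0 $ j) * (bus_surplus net \<eta> V pG j - damping net j * \<omega> $ j)) +
     m * (\<Sum>j\<in>N_dc net. (V $ j - V0 $ j) * (bus_surplus net \<eta> V pG j - pX $ j)) =
     - dissipation (state_of net \<eta> \<omega> V)"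
proof -
  have rel0: "algebraic_relations net Q p_nom m \<eta>0 \<omega>0 V0 pG0 pX0"
    and eq_ac: "\<And>i j. (i, j) \<in> E_ac net \<Longrightarrow> \<omega>0 $ i = \<omega>0 $ j"
    and eq_G: "\<And>j. j \<in> N_gen \<Longrightarrow> bus_surplus net \<eta>0 V0 pG0 j = damping net j * \<omega>0 $ j"
    and eq_dc: "\<And>j. j \<in> N_dc net \<Longrightarrow> bus_surplus net \<eta>0 V0 pG0 j = pX0 $ j"
    using equilibrium by (auto simp: closed_loop_equilibrium_def)
  define u where "u j = droop_signal net m \<omega> V $ j - droop_signal net m \<omega>0 V0 $ j" for j
  define d where "d j = bus_surplus net \<eta> V pG j - bus_surplus net \<eta>0 V0 pG0 j" for j
  define x where "x j = pX $ j - pX0 $ j" for j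
  have u: "j \<in> N_ac net \<Longrightarrow> u j = \<omega> $ j - \<omega>0 $ j" "j \<in> N_dc net \<Longrightarrow> u j = m * (V $ j - V0 $ j)" for j
    using dc_notin_ac[of j] by (auto simp: u_def droop_signal_def algebra_simps)
  have split_sum: "(\<Sum>j\<in>UNIV. f j) = (\<Sum>j\<in>N_gen. f j) + (\<Sum>j\<in>X_ac net. f j) + (\<Sum>j\<in>N_dc net. f j)"
    for f :: "'b \<Rightarrow> real"
  proof -
    have U: "UNIV = (N_gen \<union> X_ac net) \<union> N_dc net" using bus_cases X_subset by auto
    have "sum f UNIV = sum f (N_gen \<union> X_ac net) + sum f (N_dc net)"
      using dc_notin_ac X_subset by (subst U, intro sum.union_disjoint) auto
    also have "sum f (N_gen \<union> X_ac net) = sum f N_gen + sum f (X_ac net)"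
      by (rule sum.union_disjoint) auto
    finally show ?thesis .
  qed

  \<comment> \<open>The two ends of a converter share the same \<open>u\<close>, by the converter
    control, and have opposite \<open>x\<close>; at DC buses without converter \<open>x\<close> is
    zero.\<close>
  have ilc: "(\<Sum>j\<in>X_ac net. u j * x j) + (\<Sum>j\<in>N_dc net. u j * x j) = 0"
  proof -
    have "(\<Sum>j\<in>N_dc net. u j * x j) = (\<Sum>j\<in>X_dc net. u j * x j)"
    proof (rule sum.mono_neutral_right)
      show "\<forall>j\<in>N_dc net - X_dc net. u j * x j = 0"
      proof
        fix j assume "j \<in> N_dc net - X_dc net"
        then have "j \<notin> X_ac net \<union> X_dc net" using dc_notin_ac X_subset by auto
        then show "u j * x j = 0" using rel rel0 by (auto simp: x_def algebraic_relations_def)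
      qed
    qed (use X_subset in auto)
    moreover have "(\<Sum>j\<in>X_ac net. u j * x j) = (\<Sum>k\<in>ilcs net. u (ilc_ac net k) * x (ilc_ac net k))"
      unfolding X_ac_def by (rule sum.reindex_cong[OF ilcs(2)]) auto
    moreover have "(\<Sum>j\<in>X_dc net. u j * x j) = (\<Sum>k\<in>ilcs net. u (ilc_dc net k) * x (ilc_dc net k))"
      unfolding X_dc_def by (rule sum.reindex_cong[OF ilcs(3)]) auto
    moreover have "u (ilc_ac net k) * x (ilc_ac net k) + u (ilc_dc net k) * x (ilc_dc net k) = 0"
      if "k \<in> ilcs net" for k
      using rel rel0 that ilc_ends[OF that]
      by (simp add: u x_def algebraic_relations_def algebra_simps)
    ultimately show ?thesis by (simp add: sum.distrib[symmetric])
  qed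

  have X: "d j = x j" if "j \<in> X_ac net" for j
    using rel rel0 that by (auto simp: d_def x_def algebraic_relations_def)

  have droop: "(\<Sum>j\<in>UNIV. u j * (pG $ j - pG0 $ j)) =
      - (\<Sum>j\<in>N_gen. inverse (Q $ j $ j) * (\<omega> $ j - \<omega>0 $ j)\<^sup>2) -
      (\<Sum>j\<in>N_dc net. inverse (Q $ j $ j) * m\<^sup>2 * (V $ j - V0 $ j)\<^sup>2)"
  proof -
    have p: "pG $ j - pG0 $ j = (if j \<in> X_ac net then 0 else - inverse (Q $ j $ j) * u j)" for j
    proof -
      have "pG $ j = (- (Q_tilde net Q *v droop_signal net m \<omega> V) + p_nom) $ j"
        "pG0 $ j = (- (Q_tilde net Q *v droop_signal net m \<omega>0 V0) + p_nom) $ j"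
        using rel rel0 by (simp_all add: algebraic_relations_def)
      then show ?thesis
        by (cases "j \<in> X_ac net") (simp_all add: Q_tilde_mult_nth u_def algebra_simps)
    qed
    have "(\<Sum>j\<in>N_gen. u j * (pG $ j - pG0 $ j)) = (\<Sum>j\<in>N_gen. - (inverse (Q $ j $ j) * (\<omega> $ j - \<omega>0 $ j)\<^sup>2))"
      by (rule sum.cong) (auto simp: p u power2_eq_square)
    moreover have "(\<Sum>j\<in>X_ac net. u j * (pG $ j - pG0 $ j)) = 0" by (simp add: p)
    moreover have "(\<Sum>j\<in>N_dc net. u j * (pG $ j - pG0 $ j)) =
        (\<Sum>j\<in>N_dc net. - (inverse (Q $ j $ j) * m\<^sup>2 * (V $ j - V0 $ j)\<^sup>2))"
      using dc_notin_ac X_subset by (intro sum.cong) (auto simp: p u power2_eq_square)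
    ultimately show ?thesis by (simp add: split_sum sum_negf)
  qed

  \<comment> \<open>After summation by parts, an AC line sees the full frequency difference because
    the equilibrium frequencies at its ends coincide, and a DC line yields a square because flow and
    \<open>u\<close> are both driven by voltage differences.\<close>
  have flow: "(\<Sum>j\<in>UNIV. u j * (net_inflow net (line_power net \<eta> V) j - net_inflow net (line_power net \<eta>0 V0) j)) =
      - (\<Sum>e\<in>E_ac net. susceptance net e * (sin (\<eta> $ e) - sin (\<eta>0 $ e)) * (\<omega> $ fst e - \<omega> $ snd e)) -
      m * (\<Sum>(i, j)\<in>E_dc net. conductance net (i, j) * ((V $ i - V0 $ i) - (V $ j - V0 $ j))\<^sup>2)"
  proof -
    let ?p = "line_power net \<eta> V" and ?q = "line_power net \<eta>0 V0"
    let ?f = "\<lambda>(i, j). (?p (i, j) - ?q (i, j)) * (u j - u i)"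
    have "(\<Sum>j\<in>UNIV. u j * (net_inflow net ?p j - net_inflow net ?q j)) = sum ?f (lines net)"
      by (simp add: right_diff_distrib sum_subtractf sum_mult_net_inflow left_diff_distrib
          case_prod_unfold)
    also have "\<dots> = sum ?f (E_ac net) + sum ?f (E_dc net)"
      by (simp add: lines_eq sum.union_disjoint E_disjoint)
    also have "sum ?f (E_ac net) = (\<Sum>e\<in>E_ac net. - (susceptance net e *
        (sin (\<eta> $ e) - sin (\<eta>0 $ e)) * (\<omega> $ fst e - \<omega> $ snd e)))"
      using eq_ac line_ends
      by (intro sum.cong) (auto simp: line_power_def u algebra_simps)
    also have "sum ?f (E_dc net) = (\<Sum>(i, j)\<in>E_dc net. - (m * (conductance net (i, j) *
        ((V $ i - V0 $ i) - (V $ j - V0 $ j))\<^sup>2)))"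
    proof (rule sum.cong, simp)
      fix e assume e: "e \<in> E_dc net"
      obtain i j where ij: "e = (i, j)" by force
      let ?d = "(V $ i - V0 $ i) - (V $ j - V0 $ j)"
      have "(i, j) \<notin> E_ac net" using e ij E_disjoint by auto
      then have p: "?p (i, j) - ?q (i, j) = conductance net (i, j) * ?d"
        by (simp add: line_power_def algebra_simps)
      have "i \<in> N_dc net" "j \<in> N_dc net" using e ij line_ends by auto
      then have "u j - u i = - m * ?d" by (simp add: u(2) algebra_simps)
      with p show "?f e = (case e of (i, j) \<Rightarrow> - (m * (conductance net (i, j) *
          ((V $ i - V0 $ i) - (V $ j - V0 $ j))\<^sup>2)))"
        unfolding ij prod.case by (simp add: power2_eq_square)
    qed
    finally show ?thesis
      by (simp add: sum_negf sum_distrib_left case_prod_unfold)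
  qed

  have "(\<Sum>j\<in>UNIV. u j * d j) = (\<Sum>j\<in>UNIV. u j * (pG $ j - pG0 $ j)) +
      (\<Sum>j\<in>UNIV. u j * (net_inflow net (line_power net \<eta> V) j - net_inflow net (line_power net \<eta>0 V0) j))"
    by (simp add: sum.distrib[symmetric] d_def bus_surplus_def algebra_simps)
  moreover have "(\<Sum>j\<in>UNIV. u j * d j) =
      (\<Sum>j\<in>N_gen. u j * d j) + (\<Sum>j\<in>X_ac net. u j * x j) + (\<Sum>j\<in>N_dc net. u j * d j)"
    by (simp add: split_sum X)
  moreover have "(\<Sum>j\<in>N_gen. (\<omega> $ j - \<omega>0 $ j) * (bus_surplus net \<eta> V pG j - damping net j * \<omega> $ j)) =
      (\<Sum>j\<in>N_gen. u j * d j) - (\<Sum>j\<in>N_gen. damping net j * (\<omega> $ j - \<omega>0 $ j)\<^sup>2)"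
    unfolding sum_subtractf[symmetric]
    by (rule sum.cong) (auto simp: u d_def eq_G power2_eq_square algebra_simps)
  moreover have "m * (\<Sum>j\<in>N_dc net. (V $ j - V0 $ j) * (bus_surplus net \<eta> V pG j - pX $ j)) =
      (\<Sum>j\<in>N_dc net. u j * d j) - (\<Sum>j\<in>N_dc net. u j * x j)"
    unfolding sum_subtractf[symmetric] sum_distrib_left
    by (rule sum.cong) (auto simp: u d_def x_def eq_dc algebra_simps)
  moreover have "(\<Sum>j\<in>N_gen. (inverse (Q $ j $ j) + damping net j) * (\<omega> $ j - \<omega>0 $ j)\<^sup>2) =
      (\<Sum>j\<in>N_gen. inverse (Q $ j $ j) * (\<omega> $ j - \<omega>0 $ j)\<^sup>2) + (\<Sum>j\<in>N_gen. damping net j * (\<omega> $ j - \<omega>0 $ j)\<^sup>2)"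
    by (simp add: sum.distrib distrib_right)
  ultimately show ?thesis
    unfolding dissipation_state_of using ilc droop flow by linarith
qed

text \<open>Differentiating the energy term by term along the solution gives the left side of
  \<open>power_balance\<close>.\<close>

lemma energy_has_derivative:
  assumes sol: "closed_loop_solution net Q p_nom m \<eta> \<omega> V pG pX" and t: "t \<ge> 0"
  shows "((\<lambda>s. energy (state_of net (\<eta> s) (\<omega> s) (V s))) has_real_derivative
           - dissipation (state_of net (\<eta> t) (\<omega> t) (V t))) (at t within {0..})"
proof -
  have rel: "algebraic_relations net Q p_nom m (\<eta> t) (\<omega> t) (V t) (pG t) (pX t)"
    using sol t by (auto simp: closed_loop_solution_def)
  have ang: "((\<lambda>s. susceptance net e * (cos (\<eta>0 $ e) - cos (\<eta> s $ e) - (\<eta> s $ e - \<eta>0 $ e) * sin (\<eta>0 $ e)))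
      has_real_derivative susceptance net e * (sin (\<eta> t $ e) - sin (\<eta>0 $ e)) *
        (\<omega> t $ fst e - \<omega> t $ snd e)) (at t within {0..})" if "e \<in> E_ac net" for e
  proof -
    have "((\<lambda>s. \<eta> s $ e) has_real_derivative \<omega> t $ fst e - \<omega> t $ snd e) (at t within {0..})"
      using sol t that by (cases e) (auto simp: closed_loop_solution_def)
    then show ?thesis
      by (auto intro!: derivative_eq_intros simp: algebra_simps)
  qed
  have quad: "((\<lambda>s. c / 2 * (f s - a)\<^sup>2) has_real_derivative (f t - a) * D) (at t within {0..})"
    if "((\<lambda>s. c * f s) has_real_derivative D) (at t within {0..})" "c > 0" for c a D :: real and f
  proof -
    have "(f has_real_derivative D / c) (at t within {0..})"
      using DERIV_cdivide[OF that(1), of c] that(2) by simp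
    then show ?thesis
      using that(2) by (auto intro!: derivative_eq_intros simp: field_simps)
  qed
  have fr: "((\<lambda>s. inertia net j / 2 * (\<omega> s $ j - \<omega>0 $ j)\<^sup>2) has_real_derivative
      (\<omega> t $ j - \<omega>0 $ j) * (bus_surplus net (\<eta> t) (V t) (pG t) j - damping net j * \<omega> t $ j))
      (at t within {0..})" if "j \<in> N_gen" for j
    using sol t that parameters_pos(1)[OF that] by (intro quad) (auto simp: closed_loop_solution_def)
  have vo: "((\<lambda>s. capacitance net j / 2 * (V s $ j - V0 $ j)\<^sup>2) has_real_derivative
      (V t $ j - V0 $ j) * (bus_surplus net (\<eta> t) (V t) (pG t) j - pX t $ j))
      (at t within {0..})" if "j \<in> N_dc net" for j
    using sol t that parameters_pos(3)[OF that] by (intro quad) (auto simp: closed_loop_solution_def)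
  show ?thesis
    unfolding energy_state_of power_balance[OF rel, symmetric]
    by (intro DERIV_add DERIV_sum DERIV_cmult ang fr vo)
qed

section \<open>Convergence to the equilibrium set\<close>

lemma closed_state_space: "closed (state_space net)"
proof -
  have "state_space net = {y. (\<forall>e. e \<in> E_ac net \<or> fst y $ e = 0) \<and>
      (\<forall>j. j \<in> N_gen \<or> fst (snd y) $ j = 0) \<and> (\<forall>j. j \<in> N_dc net \<or> snd (snd y) $ j = 0)}"
    (is "_ = ?R")
  proof (intro equalityI subsetI)
    fix y assume "y \<in> ?R"
    then have "y = state_of net (fst y) (fst (snd y)) (snd (snd y))"
      by (auto simp: state_of_def prod_eq_iff vec_eq_iff)
    then show "y \<in> state_space net" unfolding state_space_def by blast
  qed (auto simp: state_space_def state_of_def split: if_splits)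
  moreover have "closed ?R"
    by (intro closed_Collect_conj closed_Collect_all closed_Collect_disj closed_Collect_const
        closed_Collect_eq continuous_intros)
  ultimately show ?thesis by simp
qed

text \<open>\<open>lyapunov_attraction\<close> is applied with \<open>P = snd\<close>, which keeps
  the frequencies and voltages, exactly the coordinates that zero dissipation determines.\<close>

theorem local_attraction:
  "\<exists>U. openin (top_of_set (state_space net)) U \<and> state_of net \<eta>0 \<omega>0 V0 \<in> U \<and>
    (\<forall>\<eta> \<omega> V pG pX.
       closed_loop_solution net Q p_nom m \<eta> \<omega> V pG pX \<and> state_of net (\<eta> 0) (\<omega> 0) (V 0) \<in> U \<longrightarrow>
       ((\<lambda>t. infdist (state_of net (\<eta> t) (\<omega> t) (V t)) (equilibrium_set net Q p_nom m))
          \<longlongrightarrow> 0) at_top)"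
proof -
  let ?y0 = "state_of net \<eta>0 \<omega>0 V0"
  have y0: "?y0 \<in> state_space net" by (auto simp: state_space_def)
  \<comment> \<open>A radius so small that the AC angles stay within \<open>pi / 2\<close>
    throughout the ball; phrasing it as an eventual property also covers a network without AC
    lines.\<close>
  have "\<forall>\<^sub>F r in at_right 0. \<forall>e\<in>E_ac net. r < pi / 2 - \<bar>\<eta>0 $ e\<bar>"
    using angles by (intro eventually_ball_finite ballI eventually_at_right_real[THEN eventually_mono]) auto
  from eventually_happens[OF eventually_conj[OF this eventually_at_right_less]]
  obtain r where r: "r > 0" "\<And>e. e \<in> E_ac net \<Longrightarrow> r < pi / 2 - \<bar>\<eta>0 $ e\<bar>"
    using trivial_limit_at_right_real by blast
  have snd_eq: "snd y = snd ?y0" if "y \<in> state_space net" "dissipation y = 0" for y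
    using that dissipation_zeroD[OF that(2)]
    by (auto simp: state_space_def state_of_def vec_eq_iff)
  obtain U where U: "openin (top_of_set (state_space net)) U" "?y0 \<in> U"
    and attr: "\<And>x. (\<forall>t\<ge>0. x t \<in> state_space net \<and>
             (x has_vector_derivative field (x t)) (at t within {0..}) \<and>
             ((\<lambda>s. energy (x s)) has_real_derivative - dissipation (x t)) (at t within {0..})) \<and>
           x 0 \<in> U \<Longrightarrow> ((\<lambda>t. infdist (x t) (equilibrium_set net Q p_nom m)) \<longlongrightarrow> 0) at_top"
  proof (atomize_elim, rule lyapunov_attraction[where P = snd and r = r])
    show "energy ?y0 = 0" by (simp add: energy_state_of)
    fix y :: "'b state" assume y: "y \<in> state_space net"
    {
      assume le: "dist ?y0 y \<le> r" and "y \<noteq> ?y0"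
      moreover have "\<bar>fst y $ e\<bar> \<le> pi / 2" if "e \<in> E_ac net" for e
      proof -
        have "\<bar>\<eta>0 $ e - fst y $ e\<bar> = dist (fst ?y0 $ e) (fst y $ e)"
          using that by (simp add: state_of_def dist_real_def)
        also have "\<dots> \<le> dist ?y0 y"
          using dist_vec_nth_le dist_fst_le order_trans by blast
        finally show ?thesis using le r(2)[OF that] by linarith
      qed
      ultimately show "energy y > 0" using y by (intro energy_pos)
    }
    assume zero: "dissipation y = 0"
    then show "snd y = snd ?y0" by (rule snd_eq[OF y])
    assume rest: "snd (field y) = 0"
    \<comment> \<open>The reconstructed frequencies depend only on \<open>snd y\<close>, which has
      its equilibrium value. They agree along each AC line, so the angle part of the field vanishes
      too.\<close>
    have "frequency (fst (snd y)) (snd (snd y)) $ j = \<omega>0 $ j" if "j \<in> N_ac net" for j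
      unfolding snd_eq[OF y zero]
      using equilibrium that
      by (intro algebraic_relations_eliminated(1)[of \<eta>0 \<omega>0 V0 pG0 pX0 "fst ?y0"])
        (auto simp: closed_loop_equilibrium_def)
    then have "fst (field y) $ (i, j) = 0" for i j
      using line_ends[of i j] equilibrium
      by (auto simp: field_def Let_def closed_loop_equilibrium_def)
    then have "field y = 0" using rest by (auto simp: prod_eq_iff vec_eq_iff)
    then show "y \<in> equilibrium_set net Q p_nom m" by (rule field_zero_imp_equilibrium[OF y])
  qed (use r y0 in \<open>auto intro: closed_state_space continuous_on_field continuous_on_energy
        continuous_on_dissipation dissipation_nonneg bounded_linear_snd\<close>)
  show ?thesis
  proof (intro exI[of _ U] conjI U allI impI, elim conjE)
    fix \<eta> \<omega> V pG pX
    assume "closed_loop_solution net Q p_nom m \<eta> \<omega> V pG pX" "state_of net (\<eta> 0) (\<omega> 0) (V 0) \<in> U"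
    then show "((\<lambda>t. infdist (state_of net (\<eta> t) (\<omega> t) (V t)) (equilibrium_set net Q p_nom m))
        \<longlongrightarrow> 0) at_top"
      using solution_has_field_derivative energy_has_derivative
      by (intro attr) (auto simp: state_space_def)
  qed
qed

end

theorem theorem1:
  fixes net :: "('b::finite, 'x) hybrid_network"
    and Q :: "real^'b^'b" and l_nom m :: real and p_nom :: "real^'b"
    and \<eta>_eq :: "real^('b \<times> 'b)" and \<omega>_eq V_eq pG_eq pX_eq :: "real^'b"
  assumes network: "valid_network net"
    and cost: "diagonal_matrix Q" "positive_definite Q"
    and nominal: "nominal_generation net Q l_nom p_nom"
    and m_pos: "m > 0"
    and equilibrium: "closed_loop_equilibrium net Q p_nom m \<eta>_eq \<omega>_eq V_eq pG_eq pX_eq"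
    and angles: "\<forall>e \<in> E_ac net. \<bar>\<eta>_eq $ e\<bar> < pi / 2"
  shows "\<exists>U. openin (top_of_set (state_space net)) U \<and> state_of net \<eta>_eq \<omega>_eq V_eq \<in> U \<and>
    (\<forall>\<eta> \<omega> V pG pX.
       closed_loop_solution net Q p_nom m \<eta> \<omega> V pG pX \<and> state_of net (\<eta> 0) (\<omega> 0) (V 0) \<in> U \<longrightarrow>
       ((\<lambda>t. infdist (state_of net (\<eta> t) (\<omega> t) (V t)) (equilibrium_set net Q p_nom m))
          \<longlongrightarrow> 0) at_top)"
proof -
  \<comment> \<open>A minimizer is feasible, hence zero at the AC converter buses; this yields zero
    generation there.\<close>
  have p_nom_X: "p_nom $ j = 0" if "j \<in> X_ac net" for j
    using nominal that by (auto simp: nominal_generation_def is_arg_min_def)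
  interpret hybrid_loop_equilibrium net Q p_nom m \<eta>_eq \<omega>_eq V_eq pG_eq pX_eq
    by unfold_locales
      (use network m_pos equilibrium angles positive_definite_diagonal[OF cost(2)] p_nom_X in auto)
  show ?thesis by (rule local_attraction)
qed

end
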